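(* Consider the linear system $\dot x(t)=A(t)x(t)+B(t)u(t)$ on $[0,1]$, with the normalized state $z(t)=LF_tx(t)$ and $C_t=LF_tB(t)$ as in the context, and a partition $0=t_0<t_1<\dots<t_N=1$. Suppose that for every $k$ the local Gramian $$\mathcal G_k=\int_{t_k}^{t_{k+1}}C_sC_s^\top\,\mathrm ds$$ is positive definite. For each $k$ let $\Xi_k:\mathbb R^n\to\mathbb R^n$ be a (Borel) sliced update map, $\delta_k(z):=\Xi_k(z)-z$, and apply on $[t_k,t_{k+1}]$ the input $$u(t)=C_t^\top\mathcal G_k^{-1}\delta_k(z_{t_k}),\qquad z_{t_k}=LF_{t_k}x(t_k).$$ Then the transformed state satisfies $z_{t_{k+1}}=\Xi_k(z_{t_k})$. Consequently, the laws $\widehat\rho_k$ of $z_{t_k}$ satisfy $\widehat\rho_{k+1}=(\Xi_k)_\#\widehat\rho_k$.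
   Context: $A(t)\in\mathbb R^{n\times n}$ and $B(t)\in\mathbb R^{n\times m}$ are continuous on $[0,1]$ ($B(t)$ need not have full row rank). $\Phi(t,s)$ is the state-transition matrix of $A(\cdot)$, $F_t:=\Phi(1,t)$, $G_{10}:=\int_0^1\Phi(1,s)B(s)B(s)^\top\Phi(1,s)^\top\,\mathrm ds$ is the reachability Gramian, assumed positive definite, and $L:=G_{10}^{-1/2}$. With $\rho_t$ the law of $x(t)$ and $\rho_1$ the target law, $\widehat\rho_k=(LF_{t_k})_\#\rho_{t_k}$ and $\widehat\rho_1^{\,\rm target}=L_\#\rho_1$. A sliced update map $\Xi_k$ is a map constructed from $\widehat\rho_k$ and $\widehat\rho_1^{\,\rm target}$, for example $\Xi_k(z)=z-\alpha_k(\theta_k^\top z-\widehat{\mathcal T}_k^{\theta_k}(\theta_k^\top z))\theta_k$, with $\theta_k$ a unit vector, $\alpha_k$ a step size and $\widehat{\mathcal T}_k^{\theta}$ the one-dimensional optimal transport map between the pushforwards of $\widehat\rho_k$ and $\widehat\rho_1^{\,\rm target}$ under $z\mapsto\theta^\top z$; or its average over $\theta$, $\Xi_k(z)=z-\alpha_k\widehat g_k(z)$, $\widehat g_k(z)=\int_{\mathcal S^{n-1}}(\theta^\top z-\widehat{\mathcal T}_k^\theta(\theta^\top z))\theta\,\sigma(\mathrm d\theta)$, with $\sigma$ the uniform probability measure on the unit sphere $\mathcal S^{n-1}$. The conclusion does not depend on which choice is made. *)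

theory Defs
  imports "HOL-Probability.Probability"
begin

definition pos_def :: "real^'n^'n \<Rightarrow> bool" where
  "pos_def P \<longleftrightarrow> transpose P = P \<and> (\<forall>v. v \<noteq> 0 \<longrightarrow> v \<bullet> (P *v v) > 0)"

(* P^(-1/2) for positive definite P, where the description has exactly one solution;
   unspecified otherwise. *)
definition inv_sqrt :: "real^'n^'n \<Rightarrow> real^'n^'n" where
  "inv_sqrt P = (THE R. pos_def R \<and> R ** R = matrix_inv P)"

(* For continuous A this determines Phi t s uniquely for all s, t in [0,1]; values
   outside that square are irrelevant. Derivatives at 0 and 1 are one-sided. *)
definition is_state_transition ::
  "(real \<Rightarrow> real^'n^'n) \<Rightarrow> (real \<Rightarrow> real \<Rightarrow> real^'n^'n) \<Rightarrow> bool" where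
  "is_state_transition A \<Phi> \<longleftrightarrow>
     (\<forall>s\<in>{0..1}. \<Phi> s s = mat 1 \<and>
       (\<forall>t\<in>{0..1}.
          ((\<lambda>t. \<Phi> t s) has_vector_derivative (A t ** \<Phi> t s)) (at t within {0..1})))"

definition reach_gramian ::
  "(real \<Rightarrow> real \<Rightarrow> real^'n^'n) \<Rightarrow> (real \<Rightarrow> real^'m^'n) \<Rightarrow> real^'n^'n" where
  "reach_gramian \<Phi> B =
     integral {0..1} (\<lambda>s. \<Phi> 1 s ** B s ** transpose (B s) ** transpose (\<Phi> 1 s))"

(* The matrix L F_t with L = G_10^(-1/2) and F_t = Phi(1,t). *)
definition normalizer ::
  "(real \<Rightarrow> real \<Rightarrow> real^'n^'n) \<Rightarrow> (real \<Rightarrow> real^'m^'n) \<Rightarrow> real \<Rightarrow> real^'n^'n" where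
  "normalizer \<Phi> B t = inv_sqrt (reach_gramian \<Phi> B) ** \<Phi> 1 t"

definition normalized_input_matrix ::
  "(real \<Rightarrow> real \<Rightarrow> real^'n^'n) \<Rightarrow> (real \<Rightarrow> real^'m^'n) \<Rightarrow> real \<Rightarrow> real^'m^'n" where
  "normalized_input_matrix \<Phi> B t = normalizer \<Phi> B t ** B t"

definition local_gramian ::
  "(real \<Rightarrow> real \<Rightarrow> real^'n^'n) \<Rightarrow> (real \<Rightarrow> real^'m^'n) \<Rightarrow> real \<Rightarrow> real \<Rightarrow> real^'n^'n" where
  "local_gramian \<Phi> B a b =
     integral {a..b} (\<lambda>s. normalized_input_matrix \<Phi> B s ** transpose (normalized_input_matrix \<Phi> B s))"

(* Solutions of x' = A x + B u on [0,1] for piecewise continuous inputs: x is continuous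
   and satisfies the equation except at finitely many times (where u may jump). *)
definition is_trajectory ::
  "(real \<Rightarrow> real^'n^'n) \<Rightarrow> (real \<Rightarrow> real^'m^'n) \<Rightarrow> (real \<Rightarrow> real^'m) \<Rightarrow> (real \<Rightarrow> real^'n) \<Rightarrow> bool" where
  "is_trajectory A B u x \<longleftrightarrow>
     continuous_on {0..1} x \<and>
     (\<exists>S. finite S \<and>
       (\<forall>t\<in>{0..1} - S.
          (x has_vector_derivative (A t *v x t + B t *v u t)) (at t within {0..1})))"

definition normalized_state ::
  "(real \<Rightarrow> real \<Rightarrow> real^'n^'n) \<Rightarrow> (real \<Rightarrow> real^'m^'n) \<Rightarrow> (real \<Rightarrow> real^'n) \<Rightarrow> real \<Rightarrow> real^'n" where
  "normalized_state \<Phi> B x t = normalizer \<Phi> B t *v x t"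

(* The pushforward under L F_t of the law rho_t of x(t). *)
definition normalized_law ::
  "(real \<Rightarrow> real \<Rightarrow> real^'n^'n) \<Rightarrow> (real \<Rightarrow> real^'m^'n) \<Rightarrow> 'w measure \<Rightarrow>
   ('w \<Rightarrow> real \<Rightarrow> real^'n) \<Rightarrow> real \<Rightarrow> (real^'n) measure" where
  "normalized_law \<Phi> B M x t =
     distr (distr M borel (\<lambda>\<omega>. x \<omega> t)) borel (\<lambda>v. normalizer \<Phi> B t *v v)"

definition normalized_target ::
  "(real \<Rightarrow> real \<Rightarrow> real^'n^'n) \<Rightarrow> (real \<Rightarrow> real^'m^'n) \<Rightarrow> (real^'n) measure \<Rightarrow> (real^'n) measure" where
  "normalized_target \<Phi> B \<rho>1 = distr \<rho>1 borel (\<lambda>v. inv_sqrt (reach_gramian \<Phi> B) *v v)"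

end

theory Submission imports Defs begin

text \<open>
  The fundamental matrix \<open>Y(t) = \<Phi>(t,1)\<close> is inverse to \<open>F\<^sub>t = \<Phi>(1,t)\<close>, by uniqueness for the linear
  equation; hence \<open>F' = - F Y' F = - F A\<close>, and the drift cancels in \<open>z' = L(F x)' = C u\<close>. With the
  chosen input, \<open>z' = C C\<^sup>T G\<^sub>k\<^sup>-\<^sup>1 \<delta>\<^sub>k\<close> on the \<open>k\<close>-th interval, which integrates to \<open>\<delta>\<^sub>k\<close>. For the laws,
  \<open>x(t\<^sub>k)\<close> must be measurable: this is inherited from \<open>z(t\<^sub>k)\<close>, since \<open>L F\<close> is invertible.
\<close>

section \<open>Derivatives as limits of difference quotients\<close>

text \<open>This form suits the inverse of a matrix function, whose difference quotient is given
  exactly by an algebraic identity, so that only a limit of products remains to be taken.\<close>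

lemma has_vector_derivative_iff_slope:
  "(f has_vector_derivative D) (at t within S) \<longleftrightarrow>
     ((\<lambda>s. (f s - f t) /\<^sub>R (s - t)) \<longlongrightarrow> D) (at t within S)"
proof -
  have eq: "norm ((f s - f t) - (s - t) *\<^sub>R D) / norm (s - t) = norm ((f s - f t) /\<^sub>R (s - t) - D)"
    if "s \<noteq> t" for s
  proof -
    have "(f s - f t) /\<^sub>R (s - t) - D = ((f s - f t) - (s - t) *\<^sub>R D) /\<^sub>R (s - t)"
      using that by (simp add: scaleR_right_diff_distrib)
    then show ?thesis by (simp add: divide_inverse mult.commute)
  qed
  have "(f has_vector_derivative D) (at t within S) \<longleftrightarrow>
      ((\<lambda>s. norm ((f s - f t) - (s - t) *\<^sub>R D) / norm (s - t)) \<longlongrightarrow> 0) (at t within S)"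
    unfolding has_vector_derivative_def has_derivative_iff_norm
    by (simp add: bounded_linear_scaleR_left)
  also have "\<dots> \<longleftrightarrow> ((\<lambda>s. norm ((f s - f t) /\<^sub>R (s - t) - D)) \<longlongrightarrow> 0) (at t within S)"
    by (rule filterlim_cong[OF refl refl]) (unfold eventually_at_filter, intro always_eventually allI impI eq)
  also have "\<dots> \<longleftrightarrow> ((\<lambda>s. (f s - f t) /\<^sub>R (s - t)) \<longlongrightarrow> D) (at t within S)"
    by (simp add: tendsto_norm_zero_iff LIM_zero_iff)
  finally show ?thesis .
qed

lemma has_vector_derivative_imp_continuous_on:
  assumes "\<And>t. t \<in> S \<Longrightarrow> (f has_vector_derivative f' t) (at t within S)"
  shows "continuous_on S f"
  unfolding continuous_on_eq_continuous_within
  using has_vector_derivative_continuous[OF assms] by blast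

section \<open>Matrix products and differentiation of an inverse\<close>

lemma bounded_bilinear_matrix_matrix_mult:
  "bounded_bilinear ((**) :: real^'n^'m \<Rightarrow> real^'p^'n \<Rightarrow> real^'p^'m)"
  unfolding bilinear_conv_bounded_bilinear[symmetric] bilinear_def
  by (auto simp: linear_iff matrix_matrix_mult_def vec_eq_iff algebra_simps sum.distrib sum_distrib_left)

lemma bounded_bilinear_matrix_vector_mult:
  "bounded_bilinear ((*v) :: real^'n^'m \<Rightarrow> real^'n \<Rightarrow> real^'m)"
  unfolding bilinear_conv_bounded_bilinear[symmetric] bilinear_def
  by (auto simp: linear_iff matrix_vector_mult_def vec_eq_iff algebra_simps sum.distrib sum_distrib_left)

lemma bounded_linear_transpose: "bounded_linear (transpose :: real^'n^'m \<Rightarrow> real^'m^'n)"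
  unfolding linear_conv_bounded_linear[symmetric]
  by (auto simp: linear_iff transpose_def vec_eq_iff)

text \<open>Rests on F(s) - F(t) = -F(s) (Y(s) - Y(t)) F(t). The right side still contains F(s), for
  which no bound is known in advance; smallness of Y(s) - Y(t) supplies one, because the term can
  then be absorbed on the left.\<close>

lemma tendsto_matrix_left_inverse:
  fixes F Y :: "real \<Rightarrow> real^'n^'n"
  assumes inv: "\<And>s. s \<in> S \<Longrightarrow> F s ** Y s = mat 1" and t: "t \<in> S"
    and Y: "(Y \<longlongrightarrow> Y t) (at t within S)"
  shows "(F \<longlongrightarrow> F t) (at t within S)"
proof -
  interpret mm: bounded_bilinear "(**) :: real^'n^'n \<Rightarrow> real^'n^'n \<Rightarrow> real^'n^'n"
    by (rule bounded_bilinear_matrix_matrix_mult)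
  obtain K where K: "K > 0" "\<And>(P :: real^'n^'n) (Q :: real^'n^'n). norm (P ** Q) \<le> norm P * norm Q * K"
    using mm.pos_bounded by auto
  \<comment> \<open>\<open>d s\<close> collects everything that multiplies \<open>norm (F s)\<close>
    after the product bound has been applied twice, hence the two factors \<open>K\<close>.\<close>
  define d where "d s = norm (Y s - Y t) * norm (F t) * K * K" for s
  have right: "Y s ** F s = mat 1" if "s \<in> S" for s
    by (rule iffD1[OF matrix_left_right_inverse inv[OF that]])
  have diff: "norm (F s - F t) \<le> norm (F s) * d s" if s: "s \<in> S" for s
  proof -
    have "F s ** (Y s - Y t) ** F t = (F s ** Y s) ** F t - F s ** (Y t ** F t)"
      by (simp add: mm.diff_left mm.diff_right matrix_mul_assoc)
    then have "F s - F t = - (F s ** ((Y s - Y t) ** F t))"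
      using inv[OF s] right[OF t] by (simp add: matrix_mul_assoc)
    then have "norm (F s - F t) = norm (F s ** ((Y s - Y t) ** F t))" by simp
    also have "\<dots> \<le> norm (F s) * norm ((Y s - Y t) ** F t) * K" by (rule K)
    also have "\<dots> \<le> norm (F s) * (norm (Y s - Y t) * norm (F t) * K) * K"
      using K by (intro mult_right_mono mult_left_mono) auto
    finally show ?thesis by (simp add: d_def mult_ac)
  qed
  have d0: "(d \<longlongrightarrow> 0) (at t within S)"
    unfolding d_def by (intro tendsto_mult_left_zero tendsto_norm_zero LIM_zero Y)
  have "eventually (\<lambda>s. s \<in> S) (at t within S)" by (simp add: eventually_at_filter)
  \<comment> \<open>Below 1/2, the estimate gives |F(s)| \<le> |F(t)| + |F(s)|/2, hence |F(s)| \<le>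
    2 |F(t)|.\<close>
  moreover have "eventually (\<lambda>s. d s < 1/2) (at t within S)"
    by (rule order_tendstoD(2)[OF d0]) simp
  ultimately have ev: "eventually (\<lambda>s. norm (F s - F t) \<le> 2 * norm (F t) * d s) (at t within S)"
  proof eventually_elim
    case (elim s)
    have "norm (F s) * d s \<le> norm (F s) * (1/2)"
      by (rule mult_left_mono) (use elim in auto)
    then have "norm (F s) \<le> 2 * norm (F t)"
      using diff[OF elim(1)] norm_triangle_sub[of "F s" "F t"] by linarith
    moreover have "0 \<le> d s" using K by (simp add: d_def)
    ultimately show ?case
      using diff[OF elim(1)] by (meson mult_right_mono order_trans)
  qed
  have "((\<lambda>s. F s - F t) \<longlongrightarrow> 0) (at t within S)"
    by (rule Lim_null_comparison[OF ev]) (intro tendsto_mult_right_zero d0)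
  then show ?thesis by (rule LIM_zero_cancel)
qed

text \<open>The same identity, divided by s - t, writes the slope of F as -F(s) times the slope of Y
  times F(t); continuity of F at t then gives the limit. Working within \<open>S\<close> keeps
  one-sided derivatives at endpoints.\<close>

lemma has_vector_derivative_matrix_left_inverse:
  fixes F Y :: "real \<Rightarrow> real^'n^'n"
  assumes inv: "\<And>s. s \<in> S \<Longrightarrow> F s ** Y s = mat 1" and t: "t \<in> S"
    and Y: "(Y has_vector_derivative Y') (at t within S)"
  shows "(F has_vector_derivative - (F t ** Y' ** F t)) (at t within S)"
proof -
  interpret mm: bounded_bilinear "(**) :: real^'n^'n \<Rightarrow> real^'n^'n \<Rightarrow> real^'n^'n"
    by (rule bounded_bilinear_matrix_matrix_mult)
  have "(Y \<longlongrightarrow> Y t) (at t within S)"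
    using has_vector_derivative_continuous[OF Y] by (simp add: continuous_within)
  then have F: "(F \<longlongrightarrow> F t) (at t within S)"
    by (rule tendsto_matrix_left_inverse[OF _ t, rotated]) (rule inv)
  have slope: "(F s - F t) /\<^sub>R (s - t) = - (F s ** ((Y s - Y t) /\<^sub>R (s - t)) ** F t)" if "s \<in> S" for s
  proof -
    have "Y t ** F t = mat 1" by (rule iffD1[OF matrix_left_right_inverse inv[OF t]])
    moreover have "F s ** (Y s - Y t) ** F t = (F s ** Y s) ** F t - F s ** (Y t ** F t)"
      by (simp add: mm.diff_left mm.diff_right matrix_mul_assoc)
    ultimately have "F s - F t = - (F s ** (Y s - Y t) ** F t)"
      using inv[OF that] by simp
    then show ?thesis by (simp add: mm.scaleR_left mm.scaleR_right)
  qed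
  have "((\<lambda>s. - (F s ** ((Y s - Y t) /\<^sub>R (s - t)) ** F t)) \<longlongrightarrow> - (F t ** Y' ** F t)) (at t within S)"
    by (intro tendsto_minus mm.tendsto F tendsto_const)
      (use Y in \<open>simp add: has_vector_derivative_iff_slope\<close>)
  then show ?thesis
    unfolding has_vector_derivative_iff_slope
    by (rule Lim_transform_eventually) (auto simp: eventually_at_filter slope)
qed

section \<open>Uniqueness for linear equations and the transition matrix\<close>

text \<open>A Gronwall argument: since |(f \<bullet> f)'| \<le> 2K (f \<bullet> f), a suitable
  exponential weight makes f \<bullet> f monotone, and it vanishes at \<open>c\<close>.\<close>

lemma linear_growth_derivative_eq_0:
  fixes f f' :: "real \<Rightarrow> 'a::real_inner"
  assumes der: "\<And>t. t \<in> {a..b} \<Longrightarrow> (f has_vector_derivative f' t) (at t within {a..b})"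
    and bound: "\<And>t. t \<in> {a..b} \<Longrightarrow> norm (f' t) \<le> K * norm (f t)"
    and c: "c \<in> {a..b}" "f c = 0" and t: "t \<in> {a..b}"
  shows "f t = 0"
proof -
  have cont: "continuous_on {a..b} f"
    using der by (rule has_vector_derivative_imp_continuous_on)
  define g where "g \<kappa> s = f s \<bullet> f s * exp (\<kappa> * s)" for \<kappa> s
  have contg: "continuous_on {a..b} (g \<kappa>)" for \<kappa>
    unfolding g_def by (intro continuous_intros cont)
  have derg: "(g \<kappa> has_real_derivative (2 * (f s \<bullet> f' s) + \<kappa> * (f s \<bullet> f s)) * exp (\<kappa> * s)) (at s)"
    if "a < s" "s < b" for s \<kappa>
  proof -
    have "(f has_vector_derivative f' s) (at s)"
      using der[of s] that at_within_Icc_at[of a s b] by simp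
    from bounded_bilinear.has_vector_derivative[OF bounded_bilinear_inner this this]
    have "((\<lambda>s. f s \<bullet> f s) has_real_derivative 2 * (f s \<bullet> f' s)) (at s)"
      by (simp add: has_real_derivative_iff_has_vector_derivative inner_commute)
    then show ?thesis
      unfolding g_def by (auto intro!: derivative_eq_intros simp: algebra_simps)
  qed
  have inner_bound: "\<bar>f s \<bullet> f' s\<bar> \<le> K * (f s \<bullet> f s)" if "s \<in> {a..b}" for s
  proof -
    have "\<bar>f s \<bullet> f' s\<bar> \<le> norm (f s) * norm (f' s)" by (rule Cauchy_Schwarz_ineq2)
    also have "\<dots> \<le> norm (f s) * (K * norm (f s))"
      by (intro mult_left_mono bound that) auto
    finally show ?thesis by (simp add: dot_square_norm power2_eq_square mult_ac)
  qed
  \<comment> \<open>The sign of the exponent depends on the side of \<open>c\<close>: -2K makes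
    \<open>g\<close> nonincreasing, for times after \<open>c\<close>, and 2K makes it nondecreasing,
    for times before. As the weight is positive, either choice forces f(t) \<bullet> f(t) \<le>
    0.\<close>
  have "\<exists>\<kappa>. g \<kappa> t \<le> 0"
  proof (cases "c \<le> t")
    case True
    have "g (- 2 * K) t \<le> g (- 2 * K) c"
    proof (rule DERIV_nonpos_imp_decreasing_open[OF True])
      fix s assume s: "c < s" "s < t"
      then have "a < s" "s < b" using c t by auto
      moreover from this have "(2 * (f s \<bullet> f' s) + (- 2 * K) * (f s \<bullet> f s)) * exp ((- 2 * K) * s) \<le> 0"
        using inner_bound[of s] by (auto simp: mult_le_0_iff abs_le_iff)
      ultimately show "\<exists>y. DERIV (g (- 2 * K)) s :> y \<and> y \<le> 0"
        using derg by blast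
    qed (use c t in \<open>auto intro!: continuous_on_subset[OF contg]\<close>)
    also have "\<dots> = 0" using c by (simp add: g_def)
    finally show ?thesis by blast
  next
    case False
    then have "t \<le> c" by simp
    then have "g (2 * K) t \<le> g (2 * K) c"
    proof (rule DERIV_nonneg_imp_increasing_open)
      fix s assume s: "t < s" "s < c"
      then have "a < s" "s < b" using c t by auto
      moreover from this have "0 \<le> (2 * (f s \<bullet> f' s) + (2 * K) * (f s \<bullet> f s)) * exp ((2 * K) * s)"
        using inner_bound[of s] by (auto simp: zero_le_mult_iff abs_le_iff)
      ultimately show "\<exists>y. DERIV (g (2 * K)) s :> y \<and> 0 \<le> y"
        using derg by blast
    qed (use c t in \<open>auto intro!: continuous_on_subset[OF contg]\<close>)
    also have "\<dots> = 0" using c by (simp add: g_def)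
    finally show ?thesis by blast
  qed
  then have "f t \<bullet> f t \<le> 0" by (auto simp: g_def mult_le_0_iff)
  then show ?thesis by (metis inner_gt_zero_iff not_le)
qed

text \<open>The composition law is not part of \<open>is_state_transition\<close>. Both \<Phi>(s,t)
  \<Phi>(t,1) and \<Phi>(s,1) solve X' = A X in s and agree at s = t, so they agree at s = 1, where
  the latter is the identity.\<close>

lemma state_transition_inverse:
  fixes A :: "real \<Rightarrow> real^'n^'n"
  assumes A: "continuous_on {0..1} A" and \<Phi>: "is_state_transition A \<Phi>" and t: "t \<in> {0..1}"
  shows "\<Phi> 1 t ** \<Phi> t 1 = mat 1"
proof -
  interpret mm: bounded_bilinear "(**) :: real^'n^'n \<Rightarrow> real^'n^'n \<Rightarrow> real^'n^'n"
    by (rule bounded_bilinear_matrix_matrix_mult)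
  obtain K where K: "K > 0" "\<And>(P :: real^'n^'n) (Q :: real^'n^'n). norm (P ** Q) \<le> norm P * norm Q * K"
    using mm.pos_bounded by auto
  have "bounded (A ` {0..1})"
    by (intro compact_imp_bounded compact_continuous_image A compact_Icc)
  then obtain a where a: "\<And>s. s \<in> {0..1} \<Longrightarrow> norm (A s) \<le> a"
    unfolding bounded_iff by blast
  define D where "D s = \<Phi> s t ** \<Phi> t 1 - \<Phi> s 1" for s
  have "D 1 = 0"
  proof (rule linear_growth_derivative_eq_0)
    fix s :: real assume s: "s \<in> {0..1}"
    have "(D has_vector_derivative (A s ** \<Phi> s t) ** \<Phi> t 1 - A s ** \<Phi> s 1) (at s within {0..1})"
      unfolding D_def
      using \<Phi> s t unfolding is_state_transition_def
      by (intro has_vector_derivative_diff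
          bounded_linear.has_vector_derivative[OF mm.bounded_linear_left]) auto
    then show "(D has_vector_derivative A s ** D s) (at s within {0..1})"
      by (simp add: D_def mm.diff_right matrix_mul_assoc)
    have "norm (A s ** D s) \<le> norm (A s) * norm (D s) * K" by (rule K)
    also have "\<dots> \<le> a * norm (D s) * K"
      using a[OF s] K by (intro mult_right_mono) auto
    finally show "norm (A s ** D s) \<le> (a * K) * norm (D s)" by (simp add: mult_ac)
  next
    show "D t = 0" using \<Phi> t by (simp add: D_def is_state_transition_def)
  qed (use t in auto)
  then show ?thesis using \<Phi> by (simp add: D_def is_state_transition_def)
qed

text \<open>\<open>is_state_transition\<close> gives derivatives in the first argument only. Passing
  to the inverse \<Phi>(s,1) moves the variable there.\<close>

lemma has_vector_derivative_state_transition_initial_time: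
  assumes "continuous_on {0..1} A" and \<Phi>: "is_state_transition A \<Phi>" and t: "t \<in> {0..1}"
  shows "((\<lambda>s. \<Phi> 1 s) has_vector_derivative - (\<Phi> 1 t ** A t)) (at t within {0..1})"
proof -
  note inv = state_transition_inverse[OF assms(1,2)]
  have "((\<lambda>s. \<Phi> s 1) has_vector_derivative A t ** \<Phi> t 1) (at t within {0..1})"
    using \<Phi> t by (simp add: is_state_transition_def)
  from has_vector_derivative_matrix_left_inverse[where F = "\<Phi> 1", OF inv t this]
  have "((\<lambda>s. \<Phi> 1 s) has_vector_derivative - (\<Phi> 1 t ** (A t ** \<Phi> t 1) ** \<Phi> 1 t)) (at t within {0..1})" .
  moreover have "\<Phi> t 1 ** \<Phi> 1 t = mat 1"
    by (rule iffD1[OF matrix_left_right_inverse inv[OF t]])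
  ultimately show ?thesis by (simp add: matrix_mul_assoc[symmetric])
qed

section \<open>Dynamics of the normalized state\<close>

text \<open>Stated at a single time with a vector \<open>u\<close>, because the equation of a
  trajectory may fail at finitely many times.\<close>

lemma has_vector_derivative_normalized_state:
  fixes A :: "real \<Rightarrow> real^'n^'n" and B :: "real \<Rightarrow> real^'m^'n"
  assumes A: "continuous_on {0..1} A" and \<Phi>: "is_state_transition A \<Phi>" and t: "t \<in> {0..1}"
    and x: "(x has_vector_derivative A t *v x t + B t *v u) (at t within {0..1})"
  shows "(normalized_state \<Phi> B x has_vector_derivative normalized_input_matrix \<Phi> B t *v u)
    (at t within {0..1})"
proof -
  interpret mm: bounded_bilinear "(**) :: real^'n^'n \<Rightarrow> real^'n^'n \<Rightarrow> real^'n^'n"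
    by (rule bounded_bilinear_matrix_matrix_mult)
  interpret mv: bounded_bilinear "(*v) :: real^'n^'n \<Rightarrow> real^'n \<Rightarrow> real^'n"
    by (rule bounded_bilinear_matrix_vector_mult)
  have "(normalizer \<Phi> B has_vector_derivative - (normalizer \<Phi> B t ** A t)) (at t within {0..1})"
    using bounded_linear.has_vector_derivative[OF mm.bounded_linear_right
        has_vector_derivative_state_transition_initial_time[OF A \<Phi> t]]
    by (simp add: normalizer_def[abs_def] mm.minus_right matrix_mul_assoc)
  from mv.has_vector_derivative[OF this x] show ?thesis
    by (simp add: normalized_state_def[abs_def] normalized_input_matrix_def mv.add_right
        mv.minus_left matrix_vector_mul_assoc)
qed

lemma continuous_on_normalizer:
  assumes "continuous_on {0..1} A" "is_state_transition A \<Phi>"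
  shows "continuous_on {0..1} (normalizer \<Phi> B)"
  unfolding normalizer_def[abs_def]
  by (intro bounded_bilinear.continuous_on[OF bounded_bilinear_matrix_matrix_mult] continuous_on_const
      has_vector_derivative_imp_continuous_on[OF has_vector_derivative_state_transition_initial_time[OF assms]])

text \<open>\<open>integral\<close> defaults to 0 on non-integrable functions; continuity of the
  integrand ensures that the Gramian is a genuine integral.\<close>

lemma local_gramian_has_integral:
  fixes A :: "real \<Rightarrow> real^'n^'n" and B :: "real \<Rightarrow> real^'m^'n"
  assumes "continuous_on {0..1} A" "continuous_on {0..1} B" "is_state_transition A \<Phi>"
    and "{a..b} \<subseteq> {0..1}"
  shows "((\<lambda>s. normalized_input_matrix \<Phi> B s ** transpose (normalized_input_matrix \<Phi> B s))
    has_integral local_gramian \<Phi> B a b) {a..b}"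
proof -
  have C: "continuous_on {0..1} (normalized_input_matrix \<Phi> B)"
    unfolding normalized_input_matrix_def[abs_def]
    by (intro bounded_bilinear.continuous_on[OF bounded_bilinear_matrix_matrix_mult]
        continuous_on_normalizer[OF assms(1,3)] assms(2))
  have "continuous_on {a..b} (\<lambda>s. normalized_input_matrix \<Phi> B s ** transpose (normalized_input_matrix \<Phi> B s))"
    by (intro bounded_bilinear.continuous_on[OF bounded_bilinear_matrix_matrix_mult]
        bounded_linear.continuous_on[OF bounded_linear_transpose] continuous_on_subset[OF C] assms(4))
  then show ?thesis
    unfolding local_gramian_def by (intro integrable_integral integrable_continuous_interval)
qed

section \<open>Steering by the Gramian and invertibility of the normalizer\<close>

lemma pos_def_imp_invertible:
  assumes "pos_def P"
  shows "invertible P"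
proof -
  have "\<forall>v. P *v v = 0 \<longrightarrow> v = 0"
    using assms by (metis inner_zero_right less_irrefl pos_def_def)
  then show ?thesis
    unfolding invertible_left_inverse matrix_left_invertible_ker by simp
qed

lemma matrix_inv_right:
  fixes P :: "real^'n^'n"
  assumes "invertible P"
  shows "P ** matrix_inv P = mat 1"
  using assms unfolding invertible_def matrix_inv_def by (rule someI2_ex) simp

text \<open>The input is prescribed on the open interval only, so nothing is asked of it at
  partition points, where it may jump.\<close>

lemma normalized_state_steering:
  fixes A :: "real \<Rightarrow> real^'n^'n" and B :: "real \<Rightarrow> real^'m^'n"
  assumes A: "continuous_on {0..1} A" and B: "continuous_on {0..1} B"
    and \<Phi>: "is_state_transition A \<Phi>"
    and ab: "0 \<le> a" "a \<le> b" "b \<le> 1"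
    and G: "invertible (local_gramian \<Phi> B a b)"
    and x: "is_trajectory A B u x"
    and u: "\<And>\<tau>. \<tau> \<in> {a<..<b} \<Longrightarrow>
      u \<tau> = transpose (normalized_input_matrix \<Phi> B \<tau>) *v (matrix_inv (local_gramian \<Phi> B a b) *v d)"
  shows "normalized_state \<Phi> B x b = normalized_state \<Phi> B x a + d"
proof -
  interpret mv: bounded_bilinear "(*v) :: real^'n^'n \<Rightarrow> real^'n \<Rightarrow> real^'n"
    by (rule bounded_bilinear_matrix_vector_mult)
  define C where "C = normalized_input_matrix \<Phi> B"
  \<comment> \<open>\<open>w\<close> does not depend on time, so integrating C C^T w yields the
    Gramian applied to \<open>w\<close>, which is \<open>d\<close>.\<close>
  define w where "w = matrix_inv (local_gramian \<Phi> B a b) *v d"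
  obtain S where S: "finite S"
    "\<And>t. t \<in> {0..1} - S \<Longrightarrow> (x has_vector_derivative (A t *v x t + B t *v u t)) (at t within {0..1})"
    and cx: "continuous_on {0..1} x"
    using x unfolding is_trajectory_def by auto
  have "((\<lambda>s. (C s ** transpose (C s)) *v w) has_integral
      normalized_state \<Phi> B x b - normalized_state \<Phi> B x a) {a..b}"
  \<comment> \<open>This version allows the finite exceptional set \<open>S\<close> and asks only
    for continuity at the endpoints.\<close>
  proof (rule fundamental_theorem_of_calculus_interior_strong[OF S(1) ab(2)])
    fix s assume s: "s \<in> {a<..<b} - S"
    then have "s \<in> {0..1}" and "at s within {0..1} = at s"
      using ab at_within_Icc_at[of 0 s 1] by auto
    then have "(normalized_state \<Phi> B x has_vector_derivative C s *v u s) (at s)"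
      using has_vector_derivative_normalized_state[where B = B, OF A \<Phi> _ S(2)[of s]] s
      by (simp add: C_def)
    then show "(normalized_state \<Phi> B x has_vector_derivative (C s ** transpose (C s)) *v w) (at s)"
      using u[of s] s by (simp add: C_def w_def matrix_vector_mul_assoc matrix_mul_assoc)
  next
    have "continuous_on {0..1} (normalized_state \<Phi> B x)"
      unfolding normalized_state_def[abs_def]
      by (intro mv.continuous_on continuous_on_normalizer[OF A \<Phi>] cx)
    then show "continuous_on {a..b} (normalized_state \<Phi> B x)"
      by (rule continuous_on_subset) (use ab in auto)
  qed
  moreover have "((\<lambda>s. (C s ** transpose (C s)) *v w) has_integral local_gramian \<Phi> B a b *v w) {a..b}"
    using has_integral_linear[OF local_gramian_has_integral[OF A B \<Phi>, of a b] mv.bounded_linear_left] ab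
    by (simp add: C_def o_def)
  ultimately have "normalized_state \<Phi> B x b - normalized_state \<Phi> B x a = local_gramian \<Phi> B a b *v w"
    by (rule has_integral_unique)
  also have "\<dots> = d"
    by (simp add: w_def matrix_vector_mul_assoc matrix_inv_right[OF G])
  finally show ?thesis by (simp add: algebra_simps)
qed

text \<open>
  Factoring \<open>L\<close> out of the local Gramian yields its invertibility without existence and uniqueness
  of the square root behind \<open>inv_sqrt\<close>.
\<close>

lemma invertible_normalizer:
  fixes A :: "real \<Rightarrow> real^'n^'n" and B :: "real \<Rightarrow> real^'m^'n"
  assumes A: "continuous_on {0..1} A" and B: "continuous_on {0..1} B"
    and \<Phi>: "is_state_transition A \<Phi>" and ab: "{a..b} \<subseteq> {0..1}"
    and G: "invertible (local_gramian \<Phi> B a b)" and t: "t \<in> {0..1}"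
  shows "invertible (normalizer \<Phi> B t)"
proof -
  interpret mm: bounded_bilinear "(**) :: real^'n^'n \<Rightarrow> real^'n^'n \<Rightarrow> real^'n^'n"
    by (rule bounded_bilinear_matrix_matrix_mult)
  define L where "L = inv_sqrt (reach_gramian \<Phi> B)"
  \<comment> \<open>The Gramian integrand without its leftmost factor \<open>L\<close>; the
    transposed factor stays inside, so the Gramian is \<open>L\<close> times the integral of
    \<open>X\<close>.\<close>
  define X where "X s = \<Phi> 1 s ** B s ** transpose (normalized_input_matrix \<Phi> B s)" for s
  have F: "continuous_on {0..1} (\<lambda>s. \<Phi> 1 s)"
    by (rule has_vector_derivative_imp_continuous_on[OF has_vector_derivative_state_transition_initial_time[OF A \<Phi>]])
  have "continuous_on {0..1} X"
    unfolding X_def[abs_def] normalized_input_matrix_def[abs_def]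
    by (intro bounded_bilinear.continuous_on[OF bounded_bilinear_matrix_matrix_mult]
        bounded_linear.continuous_on[OF bounded_linear_transpose] continuous_on_normalizer[OF A \<Phi>] F B)
  then have "continuous_on {a..b} X" using ab by (rule continuous_on_subset)
  then have "(X has_integral integral {a..b} X) {a..b}"
    by (intro integrable_integral integrable_continuous_interval)
  from has_integral_linear[OF this mm.bounded_linear_right[of L]]
  have "((\<lambda>s. normalized_input_matrix \<Phi> B s ** transpose (normalized_input_matrix \<Phi> B s))
      has_integral L ** integral {a..b} X) {a..b}"
    by (simp add: o_def X_def L_def normalized_input_matrix_def normalizer_def matrix_mul_assoc)
  then have "local_gramian \<Phi> B a b = L ** integral {a..b} X"
    unfolding local_gramian_def by (rule integral_unique)
  \<comment> \<open>If R is a right inverse of the Gramian, the integral of \<open>X\<close> times R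
    is a right inverse of \<open>L\<close>, which suffices for a square matrix.\<close>
  then have "invertible L"
    using G unfolding invertible_right_inverse by (metis matrix_mul_assoc)
  moreover have "invertible (\<Phi> 1 t)"
    using state_transition_inverse[OF A \<Phi> t] unfolding invertible_right_inverse by blast
  ultimately show ?thesis
    unfolding normalizer_def L_def by (rule invertible_mult)
qed

section \<open>Measurability and laws of the normalized states\<close>

text \<open>Both directions matter: measurability passes from x to z at time 0, and from z back to x
  at later partition points.\<close>

lemma borel_measurable_matrix_vector_mult_iff:
  fixes P :: "real^'n^'n"
  assumes "invertible P"
  shows "(\<lambda>\<omega>. P *v f \<omega>) \<in> borel_measurable M \<longleftrightarrow> f \<in> borel_measurable M"
proof
  have meas: "(\<lambda>\<omega>. Q *v g \<omega>) \<in> borel_measurable M" if "g \<in> borel_measurable M"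
    for Q :: "real^'n^'n" and g
    using that by (intro borel_measurable_continuous_on[OF _ that])
      (simp add: linear_continuous_on)
  obtain Q where "Q ** P = mat 1" using assms unfolding invertible_def by blast
  then show "f \<in> borel_measurable M" if "(\<lambda>\<omega>. P *v f \<omega>) \<in> borel_measurable M"
    using meas[OF that, of Q] by (simp add: matrix_vector_mul_assoc)
  show "(\<lambda>\<omega>. P *v f \<omega>) \<in> borel_measurable M" if "f \<in> borel_measurable M"
    using that by (rule meas)
qed

theorem proposition6:
  fixes A :: "real \<Rightarrow> real^'n^'n"
    and B :: "real \<Rightarrow> real^'m^'n"
    and \<Phi> :: "real \<Rightarrow> real \<Rightarrow> real^'n^'n"
    and t :: "nat \<Rightarrow> real" and N :: nat
    and M :: "'w measure"
    and x :: "'w \<Rightarrow> real \<Rightarrow> real^'n"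
    and u :: "'w \<Rightarrow> real \<Rightarrow> real^'m"
    and \<rho>1 :: "(real^'n) measure"
    and update :: "nat \<Rightarrow> (real^'n) measure \<Rightarrow> (real^'n) measure \<Rightarrow> real^'n \<Rightarrow> real^'n"
    and \<Xi> :: "nat \<Rightarrow> real^'n \<Rightarrow> real^'n"
  assumes "continuous_on {0..1} A" and "continuous_on {0..1} B"
    and "is_state_transition A \<Phi>"
    and "pos_def (reach_gramian \<Phi> B)"
    and "t 0 = 0" and "t N = 1" and "\<And>k. k < N \<Longrightarrow> t k < t (Suc k)"
    and "\<And>k. k < N \<Longrightarrow> pos_def (local_gramian \<Phi> B (t k) (t (Suc k)))"
    and "prob_space M"
    and "(\<lambda>\<omega>. x \<omega> 0) \<in> borel_measurable M"
    and "prob_space \<rho>1" and "sets \<rho>1 = sets borel"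
    and "\<And>k. k < N \<Longrightarrow>
           \<Xi> k = update k (normalized_law \<Phi> B M x (t k)) (normalized_target \<Phi> B \<rho>1)"
    and "\<And>k. k < N \<Longrightarrow> \<Xi> k \<in> borel_measurable borel"
    and "\<And>\<omega>. \<omega> \<in> space M \<Longrightarrow> is_trajectory A B (u \<omega>) (x \<omega>)"
    and "\<And>\<omega> k \<tau>. \<omega> \<in> space M \<Longrightarrow> k < N \<Longrightarrow> \<tau> \<in> {t k<..<t (Suc k)} \<Longrightarrow>
           u \<omega> \<tau> = transpose (normalized_input_matrix \<Phi> B \<tau>) *v
                    (matrix_inv (local_gramian \<Phi> B (t k) (t (Suc k))) *v
                      (\<Xi> k (normalized_state \<Phi> B (x \<omega>) (t k)) - normalized_state \<Phi> B (x \<omega>) (t k)))"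
  shows "(\<forall>k<N. \<forall>\<omega>\<in>space M.
            normalized_state \<Phi> B (x \<omega>) (t (Suc k)) = \<Xi> k (normalized_state \<Phi> B (x \<omega>) (t k))) \<and>
         (\<forall>k<N. normalized_law \<Phi> B M x (t (Suc k)) =
                 distr (normalized_law \<Phi> B M x (t k)) borel (\<Xi> k))"
proof -
  note A = assms(1) and B = assms(2) and \<Phi> = assms(3)
  define z where "z k \<omega> = normalized_state \<Phi> B (x \<omega>) (t k)" for k \<omega>
  have mono: "t i \<le> t j" if "i \<le> j" "j \<le> N" for i j
    using that
  proof (induction j rule: dec_induct)
    case (step j)
    then show ?case using assms(7)[of j] by simp
  qed simp
  have t01: "t k \<in> {0..1}" if "k \<le> N" for k
    using mono[of 0 k] mono[of k N] that assms(5,6) by simp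
  have G: "invertible (local_gramian \<Phi> B (t k) (t (Suc k)))" if "k < N" for k
    using assms(8)[OF that] by (rule pos_def_imp_invertible)
  have steer: "z (Suc k) \<omega> = \<Xi> k (z k \<omega>)" if k: "k < N" and \<omega>: "\<omega> \<in> space M" for k \<omega>
    using normalized_state_steering[OF A B \<Phi> _ _ _ G[OF k] assms(15)[OF \<omega>] assms(16)[OF \<omega> k]]
      t01[of k] t01[of "Suc k"] mono[of k "Suc k"] k
    by (simp add: z_def)
  \<comment> \<open>There is thus a first interval, and its Gramian alone gives invertibility of the
    normalizer at every partition point, including the last one, where no interval starts.\<close>
  have "0 < N" using assms(5,6) by (cases N) auto
  then have inv: "invertible (normalizer \<Phi> B (t k))" if "k \<le> N" for k
    using invertible_normalizer[OF A B \<Phi> _ G[of 0] t01[OF that]] t01[of 0] t01[of "Suc 0"] by simp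
  have z_iff: "z k \<in> borel_measurable M \<longleftrightarrow> (\<lambda>\<omega>. x \<omega> (t k)) \<in> borel_measurable M" if "k \<le> N" for k
    unfolding z_def[abs_def] normalized_state_def
    by (rule borel_measurable_matrix_vector_mult_iff[OF inv[OF that]])
  \<comment> \<open>Only x(0) is assumed measurable; measurability propagates along z through the
    Borel maps \<open>\<Xi> k\<close>. The steering identity holds on \<open>space M\<close>, hence
    \<open>measurable_cong\<close>.\<close>
  have z_meas: "k \<le> N \<Longrightarrow> z k \<in> borel_measurable M" for k
  proof (induction k)
    case 0
    then show ?case using z_iff[of 0] assms(5,10) by simp
  next
    case (Suc k)
    then have "(\<lambda>\<omega>. \<Xi> k (z k \<omega>)) \<in> borel_measurable M"
      using measurable_compose[OF _ assms(14)[of k]] by simp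
    then show ?case
      by (rule measurable_cong[THEN iffD1, rotated]) (use Suc steer in auto)
  qed
  \<comment> \<open>\<open>normalized_law\<close> pushes forward twice, and
    \<open>distr_distr\<close> merges the two steps only for measurable maps; this is where
    measurability of x(t_k) enters.\<close>
  have law: "normalized_law \<Phi> B M x (t k) = distr M borel (z k)" if "k \<le> N" for k
    unfolding normalized_law_def
    using z_iff[OF that] z_meas[OF that]
      borel_measurable_matrix_vector_mult_iff[OF inv[OF that], of "\<lambda>v. v" borel]
    by (subst distr_distr) (auto simp: o_def z_def[abs_def] normalized_state_def)
  have "normalized_law \<Phi> B M x (t (Suc k)) = distr (normalized_law \<Phi> B M x (t k)) borel (\<Xi> k)"
    if k: "k < N" for k
  proof -
    have "distr M borel (z (Suc k)) = distr M borel (\<Xi> k \<circ> z k)"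
      by (rule distr_cong) (use steer[OF k] in auto)
    also have "\<dots> = distr (distr M borel (z k)) borel (\<Xi> k)"
      using assms(14)[OF k] z_meas k by (subst distr_distr) auto
    finally show ?thesis using law k by simp
  qed
  then show ?thesis using steer by (simp add: z_def)
qed

end
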